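(* Under the standing assumptions on the data given in the context, the value functions $V_0,\dots,V_T$ satisfy the following dynamic programming principle: for every $n\in\{0,\dots,T-1\}$ and every $\mu\in\mathcal P_2((E\times F)^{n+1})$, $$V_n(\mu)=\inf_{a_n\in\tilde{\mathfrak C}_n(\mu)}\Big\{C_n(\mu,a_n)+V_{n+1}\big(\bar P^{a_n}_{n+1}\mu\big)\Big\}.$$
   Context: Spaces and data. $E=\mathbb R^p$, $F=\mathbb R^{p'}$, $C=\mathbb R^{p''}$ with $p,p',p''\ge 1$, and $T\ge 1$ is an integer horizon. $\mathcal P_2(S)$ denotes the Borel probability measures on $S$ with finite second moment and $\mathcal W_2$ the 2-Wasserstein distance. $(\varepsilon_n)_{1\le n\le T}$ are i.i.d. square integrable $\mathbb R^d$-valued random variables; $(\eta_n)_{1\le n\le T}$ are i.i.d. square integrable $\mathbb R^{d'}$-valued random variables, independent of $(\varepsilon_n)$. For $1\le n\le T$, $G_n:E\times\mathcal P_2(E)\times C\times\mathbb R^d\to E$ and $H_n:E\times F\times C\times\mathbb R^{d'}\to F$ are measurable. (They define the hidden and observed dynamics $X_{n+1}=G_{n+1}(X_n,\mathbb P_{X_n},\alpha_n,\varepsilon_{n+1})$, $Y_{n+1}=H_{n+1}(X_{n+1},Y_n,\alpha_n,\eta_{n+1})$, with controls $\alpha_n=a_n(Y_0,\dots,Y_n)$.) The functions $c_n:E\times\mathcal P_2(E)\times C\to\mathbb R$ ($0\le n\le T-1$) and $\gamma:E\times\mathcal P_2(E)\to\mathbb R$ are measurable. Standing assumptions. There is a constant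 $K$ such that for all arguments $|G_n(x,\mu,a,e)|^2\le K(1+|x|^2+\mathcal W_2(\mu,\delta_0)^2+|a|^2+|e|^2)$ and $|H_n(x,y,a,e)|^2\le K(1+|x|^2+|y|^2+|a|^2+|e|^2)$ for $1\le n\le T$; $|c_n(x,\mu,a)|\le K(1+|x|^2+\mathcal W_2(\mu,\delta_0)^2+|a|^2)$ for $0\le n\le T-1$; $|\gamma(x,\mu)|\le K(1+|x|^2+\mathcal W_2(\mu,\delta_0)^2)$. Moreover, for all $1\le k\le T$ and $(x,y,a)\in E\times F\times C$, the random variable $H_k(x,y,a,\eta_k)$ has a Lebesgue density $e\mapsto h_k(x,y,a,e)$ on $F$, with $h_k$ jointly measurable. Notation. $x_{0:n}=(x_0,\dots,x_n)$. For $M\in\mathcal P_2((E\times F)^{n+1})$ and $0\le\ell\le n$, ${}_\ell M$ is the marginal law of the $\ell$-th pair $(x_\ell,y_\ell)$, and ${}^1_\ell M$, ${}^2_\ell M$ are its marginals on $E$ and $F$ (laws of $x_\ell$ and $y_\ell$). Controls. For $\mu\in\mathcal P_2((E\times F)^{k+1})$, $\tilde{\mathfrak C}_k(\mu)$ is the set of measurable $a_k:F^{k+1}\to C$ with $\int|a_k(y_{0:k})|^2\,d\mu(x_{0:k},y_{0:k})<\infty$. Transitions. $P^u_k(x,\mu,dx')$ is the law of $G_k(x,\mu,u,\varepsilon_k)$. For $0\le n\le T-1$, $\mu\in\mathcal P_2((E\times F)^{n+1})$, $a_n\in\tilde{\mathfrak C}_n(\mu)$, the measure $\bar P^{a_n}_{n+1}\mu\in\mathcal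 P_2((E\times F)^{n+2})$ is $$\bar P^{a_n}_{n+1}\mu(dx_{0:n+1},dy_{0:n+1})=P^{a_n(y_{0:n})}_{n+1}(x_n,{}^1_n\mu,dx_{n+1})\,h_{n+1}(x_{n+1},y_n,a_n(y_{0:n}),y_{n+1})\,dy_{n+1}\,\mu(dx_{0:n},dy_{0:n}).$$ Costs. $C_n(M,a_n)=\int c_n(x_n,{}^1_nM,a_n(y_{0:n}))\,dM(x_{0:n},y_{0:n})$ for $M\in\mathcal P_2((E\times F)^{n+1})$, $a_n\in\tilde{\mathfrak C}_n(M)$; $\Gamma(M)=\int\gamma(x_T,{}^1_TM)\,dM(x_{0:T},y_{0:T})$ for $M\in\mathcal P_2((E\times F)^{T+1})$. Value functions. For $\mu\in\mathcal P_2((E\times F)^{n+1})$ and $a=(a_k)_{0\le k\le T-1}$, set $M^{n,\mu,a}_n=\mu$, $M^{n,\mu,a}_{k+1}=\bar P^{a_k}_{k+1}M^{n,\mu,a}_k$ for $n\le k\le T-1$. ${}_n\tilde{\mathfrak C}(\mu)$ is the set of such $a$ with $a_k\in\tilde{\mathfrak C}_k(M^{n,\mu,a}_k)$ for $k=n,\dots,T-1$ (the components $a_k$, $k<n$, play no role). Then $$\bar J_n(\mu,a)=\sum_{k=n}^{T-1}C_k(M^{n,\mu,a}_k,a_k)+\Gamma(M^{n,\mu,a}_T),\qquad V_n(\mu)=\inf_{a\in{}_n\tilde{\mathfrak C}(\mu)}\bar J_n(\mu,a),$$ so $V_T=\Gamma$. Infima are understood in $[-\infty,\infty)$. *)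

theory Defs
  imports "HOL-Probability.Probability"
begin

section \<open>Measures with finite second moment and the Wasserstein distance\<close>

definition P2 :: "'a::euclidean_space measure set" where
  "P2 = {m. prob_space m \<and> sets m = sets borel \<and> (\<integral>\<^sup>+ x. ennreal ((norm x)\<^sup>2) \<partial>m) < \<infinity>}"

definition couplings ::
  "'a::euclidean_space measure \<Rightarrow> 'a measure \<Rightarrow> ('a \<times> 'a) measure set" where
  "couplings m m' = {q. sets q = sets borel \<and> distr q borel fst = m \<and> distr q borel snd = m'}"

definition W2 :: "'a::euclidean_space measure \<Rightarrow> 'a measure \<Rightarrow> real" where
  "W2 m m' =
     sqrt (enn2real (INF q \<in> couplings m m'. \<integral>\<^sup>+ z. ennreal ((norm (fst z - snd z))\<^sup>2) \<partial>q))"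

text \<open>The set \<^const>\<open>P2\<close> with the Borel sigma-algebra of the metric \<^const>\<open>W2\<close>: the generators
  are the open sets of this metric.\<close>

definition P2_borel :: "'a::euclidean_space measure measure" where
  "P2_borel = sigma P2 {U. U \<subseteq> P2 \<and> (\<forall>m\<in>U. \<exists>r>0. \<forall>m'\<in>P2. W2 m m' < r \<longrightarrow> m' \<in> U)}"

section \<open>Laws on path spaces\<close>

text \<open>A path \<open>(z\<^sub>0, \<dots>, z\<^sub>n)\<close> is an extensional function on \<open>{..n}\<close>, so that \<open>S\<^sup>n\<^sup>+\<^sup>1\<close> is the
  finite product below; its sigma-algebra is the Borel one because \<open>S\<close> is second countable.
  A path in \<open>(E \<times> F)\<^sup>n\<^sup>+\<^sup>1\<close> encodes the pair of \<open>x\<^sub>0\<^sub>:\<^sub>n\<close> and \<open>y\<^sub>0\<^sub>:\<^sub>n\<close>.\<close>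

definition path_space :: "nat \<Rightarrow> (nat \<Rightarrow> 's::euclidean_space) measure" where
  "path_space n = Pi\<^sub>M {..n} (\<lambda>_. borel)"

definition P2_path :: "nat \<Rightarrow> (nat \<Rightarrow> 's::euclidean_space) measure set" where
  "P2_path n = {M. prob_space M \<and> sets M = sets (path_space n) \<and>
     (\<integral>\<^sup>+ z. ennreal (\<Sum>i\<le>n. (norm (z i))\<^sup>2) \<partial>M) < \<infinity>}"

definition marginal_x ::
  "nat \<Rightarrow> (nat \<Rightarrow> 'x::euclidean_space \<times> 'y::euclidean_space) measure \<Rightarrow> 'x measure" where
  "marginal_x l M = distr M borel (\<lambda>z. fst (z l))"

definition y_path :: "nat \<Rightarrow> (nat \<Rightarrow> 'x \<times> 'y) \<Rightarrow> nat \<Rightarrow> 'y" where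
  "y_path n z = (\<lambda>i\<in>{..n}. snd (z i))"

section \<open>Noise\<close>

definition iid_square_integrable ::
  "'w measure \<Rightarrow> nat set \<Rightarrow> (nat \<Rightarrow> 'w \<Rightarrow> 'v::euclidean_space) \<Rightarrow> bool" where
  "iid_square_integrable W I X \<longleftrightarrow>
     prob_space.indep_vars W (\<lambda>_. borel) X I \<and>
     (\<forall>i\<in>I. \<forall>j\<in>I. distr W borel (X i) = distr W borel (X j)) \<and>
     (\<forall>i\<in>I. integrable W (\<lambda>w. (norm (X i w))\<^sup>2))"

text \<open>Independence of two families. The library's \<open>indep_var\<close> forces both variables to have the
  same value type; this is its unfolding without that restriction.\<close>

definition indep_families ::
  "'w measure \<Rightarrow> nat set \<Rightarrow> (nat \<Rightarrow> 'w \<Rightarrow> 'u::euclidean_space) \<Rightarrow>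
     (nat \<Rightarrow> 'w \<Rightarrow> 'v::euclidean_space) \<Rightarrow> bool" where
  "indep_families W I X Y \<longleftrightarrow>
     prob_space.indep_set W
       (sigma_sets (space W)
         {(\<lambda>w. \<lambda>i\<in>I. X i w) -` A \<inter> space W | A. A \<in> sets (Pi\<^sub>M I (\<lambda>_. borel))})
       (sigma_sets (space W)
         {(\<lambda>w. \<lambda>i\<in>I. Y i w) -` B \<inter> space W | B. B \<in> sets (Pi\<^sub>M I (\<lambda>_. borel))})"

section \<open>Controls, transitions, costs and value functions\<close>

definition controls ::
  "nat \<Rightarrow> (nat \<Rightarrow> 'x::euclidean_space \<times> 'y::euclidean_space) measure \<Rightarrow>
     ((nat \<Rightarrow> 'y) \<Rightarrow> 'c::euclidean_space) set" where
  "controls k M = {a. a \<in> borel_measurable (path_space k) \<and>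
     (\<integral>\<^sup>+ z. ennreal ((norm (a (y_path k z)))\<^sup>2) \<partial>M) < \<infinity>}"

definition hidden_kernel ::
  "'w measure \<Rightarrow> (nat \<Rightarrow> 'w \<Rightarrow> 'v::euclidean_space) \<Rightarrow>
     (nat \<Rightarrow> 'x::euclidean_space \<Rightarrow> 'x measure \<Rightarrow> 'c::euclidean_space \<Rightarrow> 'v \<Rightarrow> 'x) \<Rightarrow>
     nat \<Rightarrow> 'c \<Rightarrow> 'x \<Rightarrow> 'x measure \<Rightarrow> 'x measure" where
  "hidden_kernel W eps G k u x m = distr W borel (\<lambda>w. G k x m u (eps k w))"

definition transition ::
  "'w measure \<Rightarrow> (nat \<Rightarrow> 'w \<Rightarrow> 'v::euclidean_space) \<Rightarrow>
     (nat \<Rightarrow> 'x::euclidean_space \<Rightarrow> 'x measure \<Rightarrow> 'c::euclidean_space \<Rightarrow> 'v \<Rightarrow> 'x) \<Rightarrow>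
     (nat \<Rightarrow> 'x \<Rightarrow> 'y::euclidean_space \<Rightarrow> 'c \<Rightarrow> 'y \<Rightarrow> real) \<Rightarrow>
     nat \<Rightarrow> ((nat \<Rightarrow> 'y) \<Rightarrow> 'c) \<Rightarrow> (nat \<Rightarrow> 'x \<times> 'y) measure \<Rightarrow> (nat \<Rightarrow> 'x \<times> 'y) measure" where
  "transition W eps G h n a M =
     M \<bind> (\<lambda>z.
       hidden_kernel W eps G (Suc n) (a (y_path n z)) (fst (z n)) (marginal_x n M) \<bind> (\<lambda>x'.
         distr (density lborel (\<lambda>y'. ennreal (h (Suc n) x' (snd (z n)) (a (y_path n z)) y')))
           (path_space (Suc n)) (\<lambda>y'. z(Suc n := (x', y')))))"

definition stage_cost ::
  "(nat \<Rightarrow> 'x::euclidean_space \<Rightarrow> 'x measure \<Rightarrow> 'c::euclidean_space \<Rightarrow> real) \<Rightarrow>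
     nat \<Rightarrow> (nat \<Rightarrow> 'x \<times> 'y::euclidean_space) measure \<Rightarrow> ((nat \<Rightarrow> 'y) \<Rightarrow> 'c) \<Rightarrow> real" where
  "stage_cost c n M a = (\<integral> z. c n (fst (z n)) (marginal_x n M) (a (y_path n z)) \<partial>M)"

definition terminal_cost ::
  "nat \<Rightarrow> ('x::euclidean_space \<Rightarrow> 'x measure \<Rightarrow> real) \<Rightarrow>
     (nat \<Rightarrow> 'x \<times> 'y::euclidean_space) measure \<Rightarrow> real" where
  "terminal_cost T gam M = (\<integral> z. gam (fst (z T)) (marginal_x T M) \<partial>M)"

text \<open>\<open>flow \<dots> n M a k\<close> is the law at time \<open>k \<ge> n\<close> when started from \<open>M\<close> at time \<open>n\<close>; for \<open>k < n\<close> the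
  value is irrelevant.\<close>

primrec flow ::
  "'w measure \<Rightarrow> (nat \<Rightarrow> 'w \<Rightarrow> 'v::euclidean_space) \<Rightarrow>
     (nat \<Rightarrow> 'x::euclidean_space \<Rightarrow> 'x measure \<Rightarrow> 'c::euclidean_space \<Rightarrow> 'v \<Rightarrow> 'x) \<Rightarrow>
     (nat \<Rightarrow> 'x \<Rightarrow> 'y::euclidean_space \<Rightarrow> 'c \<Rightarrow> 'y \<Rightarrow> real) \<Rightarrow>
     nat \<Rightarrow> (nat \<Rightarrow> 'x \<times> 'y) measure \<Rightarrow> (nat \<Rightarrow> (nat \<Rightarrow> 'y) \<Rightarrow> 'c) \<Rightarrow>
     nat \<Rightarrow> (nat \<Rightarrow> 'x \<times> 'y) measure" where
  "flow W eps G h n M a 0 = M"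
| "flow W eps G h n M a (Suc k) =
     (if k < n then M else transition W eps G h k (a k) (flow W eps G h n M a k))"

definition policies ::
  "nat \<Rightarrow> 'w measure \<Rightarrow> (nat \<Rightarrow> 'w \<Rightarrow> 'v::euclidean_space) \<Rightarrow>
     (nat \<Rightarrow> 'x::euclidean_space \<Rightarrow> 'x measure \<Rightarrow> 'c::euclidean_space \<Rightarrow> 'v \<Rightarrow> 'x) \<Rightarrow>
     (nat \<Rightarrow> 'x \<Rightarrow> 'y::euclidean_space \<Rightarrow> 'c \<Rightarrow> 'y \<Rightarrow> real) \<Rightarrow>
     nat \<Rightarrow> (nat \<Rightarrow> 'x \<times> 'y) measure \<Rightarrow> (nat \<Rightarrow> (nat \<Rightarrow> 'y) \<Rightarrow> 'c) set" where
  "policies T W eps G h n M = {a. \<forall>k\<in>{n..<T}. a k \<in> controls k (flow W eps G h n M a k)}"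

definition total_cost ::
  "nat \<Rightarrow> 'w measure \<Rightarrow> (nat \<Rightarrow> 'w \<Rightarrow> 'v::euclidean_space) \<Rightarrow>
     (nat \<Rightarrow> 'x::euclidean_space \<Rightarrow> 'x measure \<Rightarrow> 'c::euclidean_space \<Rightarrow> 'v \<Rightarrow> 'x) \<Rightarrow>
     (nat \<Rightarrow> 'x \<Rightarrow> 'y::euclidean_space \<Rightarrow> 'c \<Rightarrow> 'y \<Rightarrow> real) \<Rightarrow>
     (nat \<Rightarrow> 'x \<Rightarrow> 'x measure \<Rightarrow> 'c \<Rightarrow> real) \<Rightarrow> ('x \<Rightarrow> 'x measure \<Rightarrow> real) \<Rightarrow>
     nat \<Rightarrow> (nat \<Rightarrow> 'x \<times> 'y) measure \<Rightarrow> (nat \<Rightarrow> (nat \<Rightarrow> 'y) \<Rightarrow> 'c) \<Rightarrow> real" where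
  "total_cost T W eps G h c gam n M a =
     (\<Sum>k=n..<T. stage_cost c k (flow W eps G h n M a k) (a k)) +
     terminal_cost T gam (flow W eps G h n M a T)"

definition value_fun ::
  "nat \<Rightarrow> 'w measure \<Rightarrow> (nat \<Rightarrow> 'w \<Rightarrow> 'v::euclidean_space) \<Rightarrow>
     (nat \<Rightarrow> 'x::euclidean_space \<Rightarrow> 'x measure \<Rightarrow> 'c::euclidean_space \<Rightarrow> 'v \<Rightarrow> 'x) \<Rightarrow>
     (nat \<Rightarrow> 'x \<Rightarrow> 'y::euclidean_space \<Rightarrow> 'c \<Rightarrow> 'y \<Rightarrow> real) \<Rightarrow>
     (nat \<Rightarrow> 'x \<Rightarrow> 'x measure \<Rightarrow> 'c \<Rightarrow> real) \<Rightarrow> ('x \<Rightarrow> 'x measure \<Rightarrow> real) \<Rightarrow>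
     nat \<Rightarrow> (nat \<Rightarrow> 'x \<times> 'y) measure \<Rightarrow> ereal" where
  "value_fun T W eps G h c gam n M =
     (INF a \<in> policies T W eps G h n M. ereal (total_cost T W eps G h c gam n M a))"

end

theory Submission
  imports Defs
begin

text \<open>The controlled law of the path evolves deterministically: running the policy \<open>a\<close> from
  \<open>\<mu>\<close> at time \<open>n\<close> is the same as taking the single transition given by \<open>a\<^sub>n\<close> and then running
  \<open>a\<close> from the resulting law at time \<open>n + 1\<close> (\<open>flow_restart\<close>). Consequently both the
  admissibility of \<open>a\<close> and its cost split into a condition on, and a cost of, \<open>a\<^sub>n\<close> at \<open>\<mu>\<close>, and
  an admissibility condition and a cost for the restarted problem (\<open>policies_split\<close>,
  \<open>total_cost_split\<close>). The restarted problem does not see \<open>a\<^sub>n\<close> (\<open>policies_past\<close>,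
  \<open>total_cost_past\<close>), so any admissible \<open>a\<^sub>n\<close> can be spliced into any policy admissible from
  time \<open>n + 1\<close>. The infimum over policies is therefore an iterated infimum, first over the
  continuation and then over \<open>a\<^sub>n\<close>, and the stage cost leaves the inner one because it is
  finite. No measurable selection enters: the state of the problem is the law itself, so the
  continuation is chosen for one law rather than for each path.

  Infinite values are harmless. The cost of a single policy is a real number, a Bochner integral
  being \<open>0\<close> if its integrand is not integrable, so that no sum \<open>\<infinity> - \<infinity>\<close> occurs. A control \<open>a\<^sub>n\<close>
  without admissible continuation belongs to no policy, and it contributes \<open>\<infinity>\<close>, the infimum over
  the empty set, to the outer infimum.\<close>

lemma flow_start:
  assumes "k \<le> n"
  shows "flow W eps G h n M a k = M"
  using assms by (cases k) auto

lemma flow_restart: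
  assumes "Suc n \<le> k"
  shows "flow W eps G h n M a k =
    flow W eps G h (Suc n) (transition W eps G h n (a n) M) a k"
  using assms
proof (induction k rule: dec_induct)
  case base
  show ?case by (simp add: flow_start)
next
  case (step k)
  then show ?case by simp
qed

lemma flow_past:
  assumes "j < n"
  shows "flow W eps G h n M (a(j := u)) k = flow W eps G h n M a k"
  using assms by (induction k) auto

lemma policies_past:
  assumes "j < n"
  shows "a(j := u) \<in> policies T W eps G h n M \<longleftrightarrow> a \<in> policies T W eps G h n M"
  using assms by (auto simp: policies_def flow_past)

lemma total_cost_past:
  assumes "j < n"
  shows "total_cost T W eps G h c gam n M (a(j := u)) = total_cost T W eps G h c gam n M a"
  using assms by (auto simp: total_cost_def flow_past intro!: sum.cong)

lemma policies_split:
  assumes "n < T"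
  shows "a \<in> policies T W eps G h n M \<longleftrightarrow>
    a n \<in> controls n M \<and>
    a \<in> policies T W eps G h (Suc n) (transition W eps G h n (a n) M)"
proof -
  have "{n..<T} = insert n {Suc n..<T}"
    using assms by auto
  then show ?thesis
    by (simp add: policies_def flow_start flow_restart)
qed

lemma total_cost_split:
  assumes "n < T"
  shows "total_cost T W eps G h c gam n M a =
    stage_cost c n M (a n) +
    total_cost T W eps G h c gam (Suc n) (transition W eps G h n (a n) M) a"
  using assms
  by (simp add: total_cost_def sum.atLeast_Suc_lessThan flow_start flow_restart)

text \<open>Translation by a finite number is an order isomorphism of the extended reals, hence the
  empty index set and infima equal to \<open>-\<infinity>\<close> need no exception.\<close>

lemma INF_ereal_translate:
  fixes f :: "'i \<Rightarrow> ereal"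
  shows "(INF i\<in>I. ereal r + f i) = ereal r + (INF i\<in>I. f i)"
proof (rule antisym)
  have "(INF i\<in>I. ereal r + f i) - ereal r \<le> f i" if "i \<in> I" for i
    using INF_lower[OF that, of "\<lambda>i. ereal r + f i"]
    by (simp add: ereal_minus_le add.commute)
  then have "(INF i\<in>I. ereal r + f i) - ereal r \<le> (INF i\<in>I. f i)"
    by (rule INF_greatest)
  then show "(INF i\<in>I. ereal r + f i) \<le> ereal r + (INF i\<in>I. f i)"
    by (simp add: ereal_minus_le add.commute)
  show "ereal r + (INF i\<in>I. f i) \<le> (INF i\<in>I. ereal r + f i)"
    by (intro INF_greatest add_left_mono INF_lower)
qed

theorem value_fun_dynamic_programming:
  assumes n: "n < T"
  shows "value_fun T W eps G h c gam n M =
    (INF u \<in> controls n M. ereal (stage_cost c n M u) +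
       value_fun T W eps G h c gam (Suc n) (transition W eps G h n u M))"
proof -
  let ?P = "\<lambda>u. policies T W eps G h (Suc n) (transition W eps G h n u M)"
  let ?J = "\<lambda>u a. ereal (stage_cost c n M u) +
    ereal (total_cost T W eps G h c gam (Suc n) (transition W eps G h n u M) a)"
  have "(INF a \<in> policies T W eps G h n M. ereal (total_cost T W eps G h c gam n M a)) =
    (INF u \<in> controls n M. INF a \<in> ?P u. ?J u a)"
  proof (rule antisym)
    show "(INF a \<in> policies T W eps G h n M. ereal (total_cost T W eps G h c gam n M a)) \<le>
      (INF u \<in> controls n M. INF a \<in> ?P u. ?J u a)"
    proof (intro INF_greatest)
      fix u a
      assume u: "u \<in> controls n M" and a: "a \<in> ?P u"
      \<comment> \<open>The policy splicing \<open>u\<close> into \<open>a\<close> is a competitor from time \<open>n\<close>, of cost \<open>?J u a\<close>.\<close>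
      have "a(n := u) \<in> policies T W eps G h n M"
        using u a by (simp add: policies_split[OF n] policies_past)
      moreover have "ereal (total_cost T W eps G h c gam n M (a(n := u))) = ?J u a"
        by (simp add: total_cost_split[OF n] total_cost_past)
      ultimately show
        "(INF a \<in> policies T W eps G h n M. ereal (total_cost T W eps G h c gam n M a)) \<le> ?J u a"
        by (metis (no_types, lifting) INF_lower)
    qed
    show "(INF u \<in> controls n M. INF a \<in> ?P u. ?J u a) \<le>
      (INF a \<in> policies T W eps G h n M. ereal (total_cost T W eps G h c gam n M a))"
    proof (intro INF_greatest)
      fix a
      assume "a \<in> policies T W eps G h n M"
      then have u: "a n \<in> controls n M" and a: "a \<in> ?P (a n)"
        by (simp_all add: policies_split[OF n])
      have "(INF u \<in> controls n M. INF a \<in> ?P u. ?J u a) \<le> ?J (a n) a"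
        by (rule INF_lower2[OF u]) (rule INF_lower[OF a])
      then show "(INF u \<in> controls n M. INF a \<in> ?P u. ?J u a) \<le>
        ereal (total_cost T W eps G h c gam n M a)"
        by (simp add: total_cost_split[OF n])
    qed
  qed
  then show ?thesis
    by (simp only: value_fun_def INF_ereal_translate)
qed

theorem mainTheorem1:
  fixes T :: nat and W :: "'w measure" and K :: real
    and eps :: "nat \<Rightarrow> 'w \<Rightarrow> real ^ 'd" and eta :: "nat \<Rightarrow> 'w \<Rightarrow> real ^ 'e"
    and G :: "nat \<Rightarrow> real ^ 'p \<Rightarrow> (real ^ 'p) measure \<Rightarrow> real ^ 'r \<Rightarrow> real ^ 'd \<Rightarrow> real ^ 'p"
    and H :: "nat \<Rightarrow> real ^ 'p \<Rightarrow> real ^ 'q \<Rightarrow> real ^ 'r \<Rightarrow> real ^ 'e \<Rightarrow> real ^ 'q"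
    and h :: "nat \<Rightarrow> real ^ 'p \<Rightarrow> real ^ 'q \<Rightarrow> real ^ 'r \<Rightarrow> real ^ 'q \<Rightarrow> real"
    and c :: "nat \<Rightarrow> real ^ 'p \<Rightarrow> (real ^ 'p) measure \<Rightarrow> real ^ 'r \<Rightarrow> real"
    and gam :: "real ^ 'p \<Rightarrow> (real ^ 'p) measure \<Rightarrow> real"
  assumes T: "1 \<le> T"
    and W: "prob_space W"
    and eps: "iid_square_integrable W {1..T} eps"
    and eta: "iid_square_integrable W {1..T} eta"
    and indep: "indep_families W {1..T} eps eta"
    and G_meas: "\<And>k. k \<in> {1..T} \<Longrightarrow>
      (\<lambda>(x, m, u, e). G k x m u e)
        \<in> borel \<Otimes>\<^sub>M P2_borel \<Otimes>\<^sub>M borel \<Otimes>\<^sub>M borel \<rightarrow>\<^sub>M borel"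
    and H_meas: "\<And>k. k \<in> {1..T} \<Longrightarrow>
      (\<lambda>(x, y, u, e). H k x y u e)
        \<in> borel \<Otimes>\<^sub>M borel \<Otimes>\<^sub>M borel \<Otimes>\<^sub>M borel \<rightarrow>\<^sub>M borel"
    and c_meas: "\<And>k. k \<in> {0..<T} \<Longrightarrow>
      (\<lambda>(x, m, u). c k x m u) \<in> borel \<Otimes>\<^sub>M P2_borel \<Otimes>\<^sub>M borel \<rightarrow>\<^sub>M borel"
    and gam_meas: "(\<lambda>(x, m). gam x m) \<in> borel \<Otimes>\<^sub>M P2_borel \<rightarrow>\<^sub>M borel"
    and G_growth: "\<And>k x m u e. k \<in> {1..T} \<Longrightarrow> m \<in> P2 \<Longrightarrow>
      (norm (G k x m u e))\<^sup>2
        \<le> K * (1 + (norm x)\<^sup>2 + (W2 m (return borel 0))\<^sup>2 + (norm u)\<^sup>2 + (norm e)\<^sup>2)"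
    and H_growth: "\<And>k x y u e. k \<in> {1..T} \<Longrightarrow>
      (norm (H k x y u e))\<^sup>2
        \<le> K * (1 + (norm x)\<^sup>2 + (norm y)\<^sup>2 + (norm u)\<^sup>2 + (norm e)\<^sup>2)"
    and c_growth: "\<And>k x m u. k \<in> {0..<T} \<Longrightarrow> m \<in> P2 \<Longrightarrow>
      \<bar>c k x m u\<bar> \<le> K * (1 + (norm x)\<^sup>2 + (W2 m (return borel 0))\<^sup>2 + (norm u)\<^sup>2)"
    and gam_growth: "\<And>x m. m \<in> P2 \<Longrightarrow>
      \<bar>gam x m\<bar> \<le> K * (1 + (norm x)\<^sup>2 + (W2 m (return borel 0))\<^sup>2)"
    and h_meas: "\<And>k. k \<in> {1..T} \<Longrightarrow>
      (\<lambda>(x, y, u, e). h k x y u e)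
        \<in> borel \<Otimes>\<^sub>M borel \<Otimes>\<^sub>M borel \<Otimes>\<^sub>M borel \<rightarrow>\<^sub>M borel"
    and h_nonneg: "\<And>k x y u e. k \<in> {1..T} \<Longrightarrow> 0 \<le> h k x y u e"
    and h_density: "\<And>k x y u. k \<in> {1..T} \<Longrightarrow>
      distributed W lborel (\<lambda>w. H k x y u (eta k w)) (\<lambda>e. ennreal (h k x y u e))"
  shows "\<forall>n\<in>{0..<T}. \<forall>\<mu>\<in>P2_path n.
    value_fun T W eps G h c gam n \<mu> =
      (INF a \<in> controls n \<mu>.
         ereal (stage_cost c n \<mu> a) +
         value_fun T W eps G h c gam (Suc n) (transition W eps G h n a \<mu>))"
  by (simp add: value_fun_dynamic_programming)

end
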